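(* Let $\mathbb{F}_q$ be a finite field with $q$ elements and let $P(X,Z)\in\mathbb{F}_q[X,Z]$ be monic in $Z$ with $\deg_Z P\ge 2$. Suppose that $$Q(X,Y,Z)=XQ_1(X,Y,Z)+Y^m-b(Z),$$ where $Q_1(X,Y,Z)\in\mathbb{F}_q[X,Y,Z]$, $b(Z)\in\mathbb{F}_q[Z]$, $\deg_Y Q_1<m$ and $m\ge 2$. Set $d_m=\gcd(m,q-1)$ and $$N_0'=\#\{(\beta,\gamma)\in\mathbb{F}_q^2\mid P(0,\gamma)=0,\ Q(0,\beta,\gamma)=0\}.$$ (i) Define $$n_0=\#\{\gamma\in\mathbb{F}_q\mid P(0,\gamma)=0,\ b(\gamma)=0\},$$ $$n_1=\#\{\gamma\in\mathbb{F}_q\mid P(0,\gamma)=0,\ b(\gamma)\ne 0,\ b(\gamma)^{(q-1)/d_m}=1\}.$$ Then $N_0'=n_0+d_m n_1$. (ii) In particular, if $b(Z)=aZ^m$ with $a\in\mathbb{F}_q$, and if $P(0,Z)$ has $r$ distinct roots in $\mathbb{F}_q$, then $$N_0'=\begin{cases} r, & a=0,\\ \delta, & a\ne 0\text{ and }a^{(q-1)/d_m}\ne 1,\\ d_m r+(1-d_m)\delta, & a\neq 0\text{ and }a^{(q-1)/d_m}=1,\end{cases}$$ where $\delta=1$ if $P(0,0)=0$ and $\delta=0$ if $P(0,0)\ne 0$.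
   Context: "Monic in $Z$" means leading coefficient $1$ as a polynomial in $Z$ over the polynomial ring in the other variables. *)

theory Defs
  imports "HOL-Computational_Algebra.Polynomial"
begin

text \<open>
  Bivariate polynomials in \<open>F[X,Z]\<close> are elements of \<open>F[X][Z]\<close> (outermost variable \<open>Z\<close>), and
  trivariate polynomials in \<open>F[X,Y,Z]\<close> are elements of \<open>F[X][Z][Y]\<close> (outermost variable \<open>Y\<close>).
  So the library's \<open>degree\<close> and \<open>lead_coeff\<close> refer to \<open>Z\<close> in the bivariate case, and
  \<open>degree\<close> is the degree in \<open>Y\<close> in the trivariate case.
\<close>

definition eval_XZ :: "'a::comm_semiring_0 poly poly \<Rightarrow> 'a \<Rightarrow> 'a \<Rightarrow> 'a" where
  "eval_XZ P x z = poly (poly P [:z:]) x"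

definition eval_XYZ :: "'a::comm_semiring_0 poly poly poly \<Rightarrow> 'a \<Rightarrow> 'a \<Rightarrow> 'a \<Rightarrow> 'a" where
  "eval_XYZ Q x y z = poly (poly (poly Q [:[:y:]:]) [:z:]) x"

definition var_X :: "'a::comm_semiring_1 poly poly poly" where
  "var_X = [:[:[:0, 1:]:]:]"

definition var_Y :: "'a::comm_semiring_1 poly poly poly" where
  "var_Y = [:0, 1:]"

definition of_poly_Z :: "'a::comm_semiring_1 poly \<Rightarrow> 'a poly poly poly" where
  "of_poly_Z b = [:map_poly (\<lambda>c. [:c:]) b:]"

lemma eval_XYZ_add: "eval_XYZ (A + B) x y z = eval_XYZ A x y z + eval_XYZ B x y z"
  by (simp add: eval_XYZ_def)

lemma eval_XYZ_diff:
  "eval_XYZ (A - B) x y z = eval_XYZ A x y z - eval_XYZ B x (y::'a::comm_ring) z"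
  by (simp add: eval_XYZ_def)

lemma eval_XYZ_mult: "eval_XYZ (A * B) x y z = eval_XYZ A x y z * eval_XYZ B x y z"
  by (simp add: eval_XYZ_def)

lemma eval_XYZ_power: "eval_XYZ (A ^ n) x y z = eval_XYZ A x y z ^ n"
  by (simp add: eval_XYZ_def)

lemma eval_XYZ_var_X: "eval_XYZ var_X x y z = x"
  by (simp add: eval_XYZ_def var_X_def)

lemma eval_XYZ_var_Y: "eval_XYZ var_Y x y z = y"
  by (simp add: eval_XYZ_def var_Y_def)

lemma eval_XYZ_of_poly_Z: "eval_XYZ (of_poly_Z b) x y z = poly b z"
  by (induction b) (simp_all add: eval_XYZ_def of_poly_Z_def map_poly_pCons)

end

theory Submission imports Defs
begin

text \<open>
  At \<open>X = 0\<close> the equation \<open>Q = 0\<close> becomes \<open>Y ^ m = b(Z)\<close>, so \<open>N0'\<close> is the sum, over the roots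
  \<open>\<gamma>\<close> of \<open>P(0, Z)\<close>, of the number of \<open>m\<close>-th roots of \<open>b(\<gamma>)\<close>.  With \<open>n = q - 1\<close>, the nonempty fibres
  of \<open>x \<mapsto> x ^ m\<close> on the nonzero elements all have the size \<open>K\<close> of \<open>{x. x ^ m = 1} = {x. x ^ d = 1}\<close>,
  so \<open>K \<le> d\<close>, and the image lies in \<open>{c. c ^ (n div d) = 1}\<close>, which has at most \<open>n div d\<close> elements.
  As the product of the two sizes is \<open>n\<close>, both bounds and the inclusion are equalities.  This
  avoids the cyclicity of the multiplicative group.
\<close>

text \<open>Multiplication by \<open>x\<close> permutes the nonzero elements. Comparing their
  product before and after, and cancelling it, leaves the power of \<open>x\<close>.\<close>

lemma finite_field_power_card_minus_1:
  fixes x :: "'a::{field,finite}"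
  assumes "x \<noteq> 0"
  shows "x ^ (card (UNIV :: 'a set) - 1) = 1"
proof -
  let ?S = "UNIV - {0 :: 'a}"
  have bij: "bij_betw ((*) x) ?S ?S"
    by (rule bij_betw_byWitness[where f' = "\<lambda>y. y / x"]) (use assms in auto)
  have "(\<Prod>y\<in>?S. y) = (\<Prod>y\<in>?S. x * y)"
    by (rule prod.reindex_bij_betw[OF bij, symmetric])
  also have "\<dots> = x ^ card ?S * (\<Prod>y\<in>?S. y)"
    by (simp add: prod.distrib)
  finally have "x ^ card ?S = 1"
    by simp
  then show ?thesis
    by (simp add: card_Diff_singleton)
qed

lemma card_roots_of_unity_le:
  assumes "k > 0"
  shows "card {x :: 'a::field. x ^ k = 1} \<le> k"
proof -
  let ?p = "monom 1 k - 1 :: 'a poly"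
  have "?p \<noteq> 0"
    using assms by (metis degree_1 degree_monom_eq eq_iff_diff_eq_0 less_irrefl zero_neq_one)
  then have "card {x. poly ?p x = 0} \<le> degree ?p"
    by (rule card_poly_roots_bound)
  also have "degree ?p \<le> k"
    by (rule degree_diff_le) (simp_all add: degree_monom_le)
  finally show ?thesis
    by (simp add: poly_monom)
qed

text \<open>Bezout in the form \<open>m * u = n * v + gcd m n\<close> has only natural exponents, so
  the argument works in any monoid. This form requires \<open>m\<close> to be nonzero; for
  \<open>m = 0\<close> the gcd is \<open>n\<close>.\<close>

lemma power_gcd_eq_1:
  fixes x :: "'a::monoid_mult"
  assumes "x ^ m = 1" "x ^ n = 1"
  shows "x ^ gcd m n = 1"
proof (cases "m = 0")
  case True
  then show ?thesis using assms by simp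
next
  case False
  then obtain u v where uv: "m * u = n * v + gcd m n"
    using bezout_nat by blast
  have "x ^ (m * u) = x ^ (n * v) * x ^ gcd m n"
    by (simp add: uv power_add)
  then show ?thesis
    using assms by (simp add: power_mult)
qed

text \<open>A fibre containing a nonzero \<open>x0\<close> is the coset of the \<open>m\<close>-th
  roots of unity through \<open>x0\<close>.\<close>

lemma card_power_fibre:
  fixes c :: "'a::field"
  assumes "x0 ^ m = c" "c \<noteq> 0" "m > 0"
  shows "card {x. x ^ m = c} = card {x :: 'a. x ^ m = 1}"
proof -
  have "x0 \<noteq> 0"
    using assms by auto
  then have "bij_betw ((*) x0) {x. x ^ m = 1} {x. x ^ m = c}"
    by (intro bij_betw_byWitness[where f' = "\<lambda>y. y / x0"])
      (use assms in \<open>auto simp: power_mult_distrib power_divide\<close>)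
  then show ?thesis
    by (simp add: bij_betw_same_card)
qed

lemma card_finite_field_roots:
  fixes c :: "'a::{field,finite}"
  defines "n \<equiv> card (UNIV :: 'a set) - 1"
  assumes "m > 0"
  shows "card {x. x ^ m = c} =
    (if c = 0 then 1 else if c ^ (n div gcd m n) = 1 then gcd m n else 0)"
proof -
  let ?S = "UNIV - {0 :: 'a}"
  define d where "d = gcd m n"
  define e where "e = n div d"
  define K where "K = card {x :: 'a. x ^ m = 1}"
  define I where "I = (\<lambda>x. x ^ m) ` ?S"
  define E where "E = {x :: 'a. x ^ e = 1}"
  have card_S: "card ?S = n"
    by (simp add: n_def card_Diff_singleton)
  have "card ?S > 0"
    by (metis Diff_iff UNIV_I card_gt_0_iff empty_iff finite singletonD zero_neq_one)
  then have n: "n > 0"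
    by (simp add: card_S)
  have unit: "x ^ n = 1" if "x \<noteq> 0" for x :: 'a
    using finite_field_power_card_minus_1[OF that] by (simp add: n_def)
  have de: "n = d * e"
    by (simp add: e_def d_def)
  have pos: "d > 0" "e > 0"
    using n de by auto
  have "{x :: 'a. x ^ m = 1} \<subseteq> {x. x ^ d = 1}"
  proof safe
    fix x :: 'a assume x: "x ^ m = 1"
    then have "x \<noteq> 0"
      using \<open>m > 0\<close> by (auto simp: zero_power)
    then show "x ^ d = 1"
      unfolding d_def by (intro power_gcd_eq_1 x unit)
  qed
  then have "K \<le> card {x :: 'a. x ^ d = 1}"
    unfolding K_def by (intro card_mono) auto
  also have "\<dots> \<le> d"
    by (rule card_roots_of_unity_le) fact
  finally have K: "K \<le> d" .
  have I_E: "I \<subseteq> E"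
  proof -
    have "(x ^ m) ^ e = 1" if "x \<noteq> 0" for x :: 'a
    proof -
      \<comment> \<open>Since \<open>d\<close> divides \<open>m\<close>, the exponent
        \<open>m * e\<close> is a multiple of \<open>n\<close>, and \<open>n\<close>-th powers of
        nonzero elements are 1.\<close>
      have "m * e = n * (m div d)"
        using de d_def by (metis dvd_mult_div_cancel gcd_dvd1 mult.assoc mult.commute)
      then have "(x ^ m) ^ e = (x ^ n) ^ (m div d)"
        by (simp flip: power_mult)
      then show ?thesis
        by (simp add: unit[OF that])
    qed
    then show ?thesis
      by (auto simp: I_def E_def)
  qed
  have E: "card E \<le> e"
    unfolding E_def by (rule card_roots_of_unity_le) fact
  have card_I: "card I \<le> card E"
    using I_E by (intro card_mono) auto
  \<comment> \<open>The nonzero elements are partitioned by the value of their \<open>m\<close>-th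
    power.\<close>
  have "n = (\<Sum>c\<in>I. card {x \<in> ?S. x ^ m = c})"
    unfolding I_def card_S[symmetric]
    using sum.image_gen[of ?S "\<lambda>_. 1::nat" "\<lambda>x. x ^ m"] by simp
  also have "\<dots> = (\<Sum>c\<in>I. K)"
  proof (rule sum.cong)
    fix c assume "c \<in> I"
    then obtain x0 where x0: "x0 \<noteq> 0" "c = x0 ^ m"
      by (auto simp: I_def)
    \<comment> \<open>The value \<open>c\<close> is nonzero, so 0 is not in its full fibre.\<close>
    then have "{x \<in> ?S. x ^ m = c} = {x. x ^ m = c}"
      using \<open>m > 0\<close> by (auto simp: zero_power)
    then show "card {x \<in> ?S. x ^ m = c} = K"
      using card_power_fibre[of x0 m c] x0 \<open>m > 0\<close> by (simp add: K_def)
  qed simp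
  finally have n_eq: "n = card I * K"
    by simp
  \<comment> \<open>With \<open>K < d\<close>, the chain
    \<open>n = card I * K \<le> e * K < e * d = n\<close> would be a contradiction.\<close>
  have "K = d"
  proof (rule ccontr)
    assume "K \<noteq> d"
    then have "e * K < e * d"
      using K pos by simp
    also have "e * d = card I * K"
      using n_eq de by (simp add: mult.commute)
    also have "\<dots> \<le> e * K"
      using card_I E by (intro mult_right_mono) auto
    finally show False
      by simp
  qed
  with n_eq de pos have "card I = e"
    by (metis mult.commute mult_cancel1 not_gr_zero)
  with E card_I have I_eq: "I = E"
    by (intro card_subset_eq I_E) auto
  consider "c = 0" | "c \<noteq> 0" "c \<in> E" | "c \<noteq> 0" "c \<notin> E"
    by blast
  then show ?thesis
  proof cases
    case 1
    then show ?thesis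
      using \<open>m > 0\<close> by simp
  next
    case 2
    then obtain x0 where "c = x0 ^ m"
      by (auto simp: I_eq[symmetric] I_def)
    then have "card {x. x ^ m = c} = d"
      using card_power_fibre[of x0 m c] 2 \<open>m > 0\<close> \<open>K = d\<close> by (simp add: K_def)
    then show ?thesis
      using 2 by (simp add: E_def d_def e_def)
  next
    case 3
    have "x ^ m \<noteq> c" for x
      using 3 \<open>m > 0\<close> by (cases "x = 0") (auto simp: I_eq[symmetric] I_def)
    then show ?thesis
      using 3 by (simp add: E_def d_def e_def)
  qed
qed

theorem theorem4p22:
  fixes P :: "'a::{field,finite} poly poly"
    and Q Q1 :: "'a poly poly poly"
    and b :: "'a poly"
    and q m d N0' n0 n1 :: nat
  assumes q: "q = card (UNIV :: 'a set)"
    and P_monic: "lead_coeff P = 1"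
    and P_deg: "degree P \<ge> 2"
    and Q: "Q = var_X * Q1 + var_Y ^ m - of_poly_Z b"
    and Q1_deg: "degree Q1 < m"
    and m: "m \<ge> 2"
    and d: "d = gcd m (q - 1)"
    and N0': "N0' = card {(\<beta>, \<gamma>). eval_XZ P 0 \<gamma> = 0 \<and> eval_XYZ Q 0 \<beta> \<gamma> = 0}"
    and n0: "n0 = card {\<gamma>. eval_XZ P 0 \<gamma> = 0 \<and> poly b \<gamma> = 0}"
    and n1: "n1 = card {\<gamma>. eval_XZ P 0 \<gamma> = 0 \<and> poly b \<gamma> \<noteq> 0
                          \<and> poly b \<gamma> ^ ((q - 1) div d) = 1}"
  shows "N0' = n0 + d * n1
    \<and> (\<forall>(a::'a) (r::nat) (\<delta>::int).
          b = monom a m \<longrightarrow>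
          r = card {\<gamma>. eval_XZ P 0 \<gamma> = 0} \<longrightarrow>
          \<delta> = (if eval_XZ P 0 0 = 0 then 1 else 0) \<longrightarrow>
            (a = 0 \<longrightarrow> int N0' = int r)
          \<and> (a \<noteq> 0 \<and> a ^ ((q - 1) div d) \<noteq> 1 \<longrightarrow> int N0' = \<delta>)
          \<and> (a \<noteq> 0 \<and> a ^ ((q - 1) div d) = 1 \<longrightarrow> int N0' = int d * int r + (1 - int d) * \<delta>))"
proof -
  define R where "R = {\<gamma>. eval_XZ P 0 \<gamma> = 0}"
  define e where "e = (q - 1) div d"
  have fib: "card {\<beta>. \<beta> ^ m = c} = (if c = 0 then 1 else if c ^ e = 1 then d else 0)" for c :: 'a
    using card_finite_field_roots[of m c] m by (simp add: d q e_def)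
  \<comment> \<open>At \<open>X = 0\<close> the summand with \<open>Q1\<close> vanishes. The swap
    moves \<open>\<gamma>\<close> to the front, so that the pairs are fibred over
    \<open>R\<close>.\<close>
  have "{(\<beta>, \<gamma>). eval_XZ P 0 \<gamma> = 0 \<and> eval_XYZ Q 0 \<beta> \<gamma> = 0}
      = prod.swap ` (SIGMA \<gamma>:R. {\<beta>. \<beta> ^ m = poly b \<gamma>})"
    by (auto simp: R_def Q eval_XYZ_add eval_XYZ_diff eval_XYZ_mult eval_XYZ_power
        eval_XYZ_var_X eval_XYZ_var_Y eval_XYZ_of_poly_Z image_iff)
  then have "N0' = (\<Sum>\<gamma>\<in>R. card {\<beta>. \<beta> ^ m = poly b \<gamma>})"
    by (simp add: N0' card_image)
  \<comment> \<open>The two conditions exclude each other, so the case distinction becomes a sum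
    whose parts are counted by \<open>n0\<close> and \<open>n1\<close>.\<close>
  also have "\<dots> = (\<Sum>\<gamma>\<in>R. (if poly b \<gamma> = 0 then 1 else 0) +
      (if poly b \<gamma> \<noteq> 0 \<and> poly b \<gamma> ^ e = 1 then d else 0))"
    by (intro sum.cong) (auto simp: fib)
  also have "\<dots> = card {\<gamma>\<in>R. poly b \<gamma> = 0} +
      d * card {\<gamma>\<in>R. poly b \<gamma> \<noteq> 0 \<and> poly b \<gamma> ^ e = 1}"
    by (simp add: sum.distrib sum.If_cases Int_def)
  finally have part1: "N0' = n0 + d * n1"
    by (simp add: n0 n1 R_def e_def)
  \<comment> \<open>The fibre over \<open>\<gamma> ^ m\<close> contains \<open>\<gamma>\<close>, so
    its size is not 0; as \<open>\<gamma> ^ m\<close> is nonzero, only the middle case of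
    \<open>fib\<close> remains.\<close>
  have unit: "(\<gamma> ^ m) ^ e = 1" if "\<gamma> \<noteq> 0" for \<gamma> :: 'a
    using fib[of "\<gamma> ^ m"] that by (auto simp: card_eq_0_iff split: if_splits)
  have part2: "(a = 0 \<longrightarrow> int N0' = int r)
      \<and> (a \<noteq> 0 \<and> a ^ e \<noteq> 1 \<longrightarrow> int N0' = \<delta>)
      \<and> (a \<noteq> 0 \<and> a ^ e = 1 \<longrightarrow> int N0' = int d * int r + (1 - int d) * \<delta>)"
    if b: "b = monom a m" and r: "r = card R"
      and \<delta>: "\<delta> = (if eval_XZ P 0 0 = 0 then 1 else 0)" for a r \<delta>
  proof (cases "a = 0")
    case True
    then show ?thesis
      \<comment> \<open>Here \<open>b = 0\<close>, so \<open>n0\<close> counts all of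
        \<open>R\<close> and \<open>n1\<close> is 0.\<close>
      using part1 by (simp add: n0 n1 b r R_def)
  next
    case False
    have zero: "poly b \<gamma> = 0 \<longleftrightarrow> \<gamma> = 0" for \<gamma>
      using False m by (simp add: b poly_monom)
    \<comment> \<open>The factor \<open>(\<gamma> ^ m) ^ e\<close> is 1, so the condition depends on
      \<open>a\<close> alone: all nonzero roots count for \<open>n1\<close>, or none does.\<close>
    have pow: "poly b \<gamma> ^ e = a ^ e" if "\<gamma> \<noteq> 0" for \<gamma>
      using unit[OF that] by (simp add: b poly_monom power_mult_distrib)
    have "{\<gamma>. eval_XZ P 0 \<gamma> = 0 \<and> poly b \<gamma> = 0} = R \<inter> {0}"
      by (auto simp: zero R_def)
    then have n0': "int n0 = \<delta>"
      by (simp add: n0 \<delta> R_def)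
    have "{\<gamma>. eval_XZ P 0 \<gamma> = 0 \<and> poly b \<gamma> \<noteq> 0 \<and> poly b \<gamma> ^ e = 1}
        = (if a ^ e = 1 then R - {0} else {})"
      by (auto simp: zero pow R_def)
    then have n1': "n1 = (if a ^ e = 1 then card (R - {0}) else 0)"
      by (simp add: n1 e_def)
    have "card R = card (R - {0}) + card (R \<inter> {0})"
      by (metis Diff_Int_distrib card_Int_Diff finite add.commute)
    \<comment> \<open>\<open>R \<inter> {0}\<close> has \<open>\<delta>\<close> elements. Integers
      are used because \<open>1 - int d\<close> can be negative.\<close>
    then have card_R0: "int (card (R - {0})) = int r - \<delta>"
      by (simp add: r \<delta> R_def)
    have "int N0' = \<delta> + int d * int n1"
      by (simp add: part1 n0')
    then show ?thesis
      using False by (simp add: n1' card_R0 algebra_simps)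
  qed
  show ?thesis
    using part1 part2 by (simp add: e_def R_def)
qed

end
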